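(* $T_1(5)=11$; that is, every triangle-free graph on $11$ vertices contains a $1$-sparse set of $5$ vertices, and there is a triangle-free graph on $10$ vertices containing no $1$-sparse set of $5$ vertices.
   Context: All graphs are finite and simple. A set $S$ of vertices of a graph $G$ is $k$-sparse if the induced subgraph $G[S]$ has maximum degree at most $k$. For integers $k\ge0$ and $j\ge1$, $T_k(j)$ denotes the minimum $n$ such that every triangle-free graph on $n$ vertices contains a $k$-sparse set of $j$ vertices. *)

theory Defs
  imports "Graph_Theory.Graph_Theory"
begin

text \<open>
  Finite simple graphs are \<^locale>\<open>pair_graph\<close>s: finite, loop-free, symmetric and without
  parallel arcs, an undirected edge being a pair of opposite arcs. The degree of a vertex
  is therefore its \<^const>\<open>out_degree\<close>.
\<close>

definition triangle_free :: "'a pair_pre_digraph \<Rightarrow> bool" where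
  "triangle_free G \<longleftrightarrow>
     \<not> (\<exists>x y z. (x, y) \<in> parcs G \<and> (y, z) \<in> parcs G \<and> (z, x) \<in> parcs G)"

definition sparse_set :: "nat \<Rightarrow> 'a pair_pre_digraph \<Rightarrow> 'a set \<Rightarrow> bool" where
  "sparse_set k G S \<longleftrightarrow>
     S \<subseteq> pverts G \<and> (\<forall>v \<in> S. out_degree (with_proj G \<restriction> S) v \<le> k)"

lemma sparse_set_altdef:
  "sparse_set k G S \<longleftrightarrow>
     S \<subseteq> pverts G \<and> (\<forall>v \<in> S. card {w \<in> S. (v, w) \<in> parcs G} \<le> k)"
proof -
  have "out_arcs (with_proj G \<restriction> S) v = Pair v ` {w \<in> S. (v, w) \<in> parcs G}"
    if "v \<in> S" for v
    using that by (auto simp: out_arcs_def)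
  then show ?thesis
    by (auto simp: sparse_set_def out_degree_def card_image inj_on_def)
qed

text \<open>
  Vertices are natural numbers here; this loses no generality, since every finite graph is
  isomorphic to one on a set of naturals.
\<close>

definition T :: "nat \<Rightarrow> nat \<Rightarrow> nat" where
  "T k j = (LEAST n. \<forall>G :: nat pair_pre_digraph.
     pair_graph G \<and> triangle_free G \<and> card (pverts G) = n \<longrightarrow>
       (\<exists>S. sparse_set k G S \<and> card S = j))"

end

theory Submission
  imports Defs
begin

text \<open>
  Suppose that a triangle-free graph on 11 vertices has no 1-sparse 5-set. Neighbourhoods are
  independent, so degrees are at most 4. If \<open>v\<close> has degree \<open>d\<close> and there is no 1-sparse
  \<open>(d + 1)\<close>-set, every vertex outside \<open>N[v]\<close> has at least two neighbours in \<open>N(v)\<close>, and double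
  counting the edges between \<open>N(v)\<close> and the rest bounds the number of vertices. For \<open>d = 4\<close> this
  is tight: the graph would be strongly regular with parameters (11, 4, 0, 2), which is impossible.
  So degrees are at most 3, and by parity some vertex \<open>v\<close> has degree at most 2. The at least 8
  vertices outside \<open>N[v]\<close> contain no 1-sparse 4-set, and the same counting forces degrees at most 2
  among them. Removing another closed neighbourhood leaves at least 5 vertices without a 1-sparse
  3-set, on which degrees are at most 1 by the same counting, a contradiction.

  The extremal graph on 10 vertices is the 5-cycle with every vertex doubled.
\<close>

section \<open>Neighbourhoods and 1-sparse sets inside a vertex subset\<close>

locale triangle_free_graph = pair_graph G for G :: "'a pair_pre_digraph" +
  assumes triangle_free: "triangle_free G"
begin

text \<open>Relative to \<open>U\<close>, so that the descent through smaller vertex sets stays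
  inside one graph.\<close>

definition nbrs :: "'a set \<Rightarrow> 'a \<Rightarrow> 'a set" where
  "nbrs U v = {w \<in> U. (v, w) \<in> parcs G}"

definition has_sparse :: "nat \<Rightarrow> 'a set \<Rightarrow> bool" where
  "has_sparse j U \<longleftrightarrow> (\<exists>S \<subseteq> U. sparse_set 1 G S \<and> card S = j)"

lemma sparse_set_nbrs: "sparse_set k G S \<longleftrightarrow> S \<subseteq> pverts G \<and> (\<forall>v \<in> S. card (nbrs S v) \<le> k)"
  unfolding sparse_set_altdef nbrs_def ..

lemma adj_commute: "(x, y) \<in> parcs G \<longleftrightarrow> (y, x) \<in> parcs G"
  using pair_sym_arcs by (auto simp: symmetric_def sym_def)

lemma no_loop: "(x, x) \<notin> parcs G"
  using pair_no_loops by fastforce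

lemma no_triangle: "(x, y) \<in> parcs G \<Longrightarrow> (x, z) \<in> parcs G \<Longrightarrow> (y, z) \<notin> parcs G"
  using triangle_free adj_commute unfolding triangle_free_def by blast

lemma finite_sub: "U \<subseteq> pverts G \<Longrightarrow> finite U"
  using pair_finite_verts finite_subset by blast

lemma nbrs_subset: "nbrs U v \<subseteq> U"
  by (auto simp: nbrs_def)

lemma nbrs_mono: "U \<subseteq> V \<Longrightarrow> nbrs U v \<subseteq> nbrs V v"
  by (auto simp: nbrs_def)

text \<open>Handshake parity, one vertex at a time: a new vertex adds its degree once at itself and
  once spread over its neighbours.\<close>

lemma even_sum_degree:
  assumes "finite U"
  shows "even (\<Sum>v\<in>U. card (nbrs U v))"
  using assms
proof (induction U rule: finite_induct)
  case (insert x U)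
  have deg_old: "card (nbrs (insert x U) v) = card (nbrs U v) + of_bool ((x, v) \<in> parcs G)"
    if "v \<in> U" for v
  proof -
    have "nbrs (insert x U) v = nbrs U v \<union> (if (x, v) \<in> parcs G then {x} else {})"
      by (auto simp: nbrs_def adj_commute)
    moreover have "x \<notin> nbrs U v" "finite (nbrs U v)"
      using insert by (auto simp: nbrs_def)
    ultimately show ?thesis by simp
  qed
  have "nbrs (insert x U) x = nbrs U x"
    by (auto simp: nbrs_def no_loop)
  moreover have "(\<Sum>v\<in>U. of_bool ((x, v) \<in> parcs G)) = card (nbrs U x)"
    using insert.hyps by (simp add: nbrs_def Collect_conj_eq)
  ultimately show ?case
    using insert by (simp add: deg_old sum.distrib)
qed simp

lemma sparse_set_subset:
  assumes "sparse_set k G S" "S' \<subseteq> S"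
  shows "sparse_set k G S'"
proof -
  have "card (nbrs S' v) \<le> card (nbrs S v)" for v
    using assms finite_sub[of S]
    by (intro card_mono nbrs_mono finite_subset[OF nbrs_subset]) (auto simp: sparse_set_nbrs)
  then show ?thesis
    using assms unfolding sparse_set_nbrs by (meson le_trans subset_iff)
qed

lemma has_sparse_of_sparse_set:
  assumes "sparse_set 1 G S" "S \<subseteq> U" "j \<le> card S"
  shows "has_sparse j U"
proof -
  obtain S' where "S' \<subseteq> S" "card S' = j"
    using assms(3) by (metis obtain_subset_with_card_n)
  then show ?thesis
    using assms sparse_set_subset unfolding has_sparse_def by blast
qed

text \<open>The descent step: \<open>v\<close> has no neighbour among the remaining vertices, so it
  joins any 1-sparse set found there as an isolated vertex.\<close>

lemma has_sparse_insert:
  assumes "U \<subseteq> pverts G" "v \<in> U" "has_sparse j (U - insert v (nbrs U v))"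
  shows "has_sparse (Suc j) U"
proof -
  obtain S where S: "S \<subseteq> U - insert v (nbrs U v)" "sparse_set 1 G S" "card S = j"
    using assms(3) unfolding has_sparse_def by blast
  have "nbrs (insert v S) v = {}"
    using S(1) by (auto simp: nbrs_def no_loop)
  moreover have "nbrs (insert v S) x = nbrs S x" if "x \<in> S" for x
    using S(1) that by (auto simp: nbrs_def adj_commute)
  ultimately have "sparse_set 1 G (insert v S)"
    using S(2) assms(1,2) unfolding sparse_set_nbrs by auto
  moreover have "card (insert v S) = Suc j"
  proof -
    have "finite S" "v \<notin> S"
      using S(1) finite_sub[OF assms(1)] finite_subset by auto
    then show ?thesis using S(3) by simp
  qed
  ultimately show ?thesis
    using S(1) assms(2) unfolding has_sparse_def by blast
qed

section \<open>Double counting the edges that leave a neighbourhood\<close>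

lemma nbrs_nbrs: "x \<in> nbrs U v \<Longrightarrow> nbrs (nbrs U v) x = {}"
  unfolding nbrs_def using no_triangle by blast

lemma sparse_set_nbhd: "U \<subseteq> pverts G \<Longrightarrow> sparse_set k G (nbrs U v)"
  using nbrs_nbrs[of _ U v] nbrs_subset[of U v] unfolding sparse_set_nbrs by auto

lemma degree_le:
  assumes "U \<subseteq> pverts G" "\<not> has_sparse (Suc d) U"
  shows "card (nbrs U v) \<le> d"
  using has_sparse_of_sparse_set[OF sparse_set_nbhd[OF assms(1)] nbrs_subset, of "Suc d"] assms(2)
  by (meson not_less_eq_eq)

text \<open>Otherwise \<open>w\<close> sends at most one edge into the independent set
  \<open>nbrs U v\<close>, and adding it gives a 1-sparse set of \<open>d + 1\<close>
  vertices.\<close>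

lemma two_common_nbrs:
  assumes "U \<subseteq> pverts G" "card (nbrs U v) = d" "\<not> has_sparse (Suc d) U"
    and w: "w \<in> U - insert v (nbrs U v)"
  shows "2 \<le> card (nbrs (nbrs U v) w)"
proof (rule ccontr)
  let ?N = "nbrs U v"
  assume "\<not> 2 \<le> card (nbrs ?N w)"
  then have le: "card (nbrs ?N w) \<le> 1" by simp
  have "nbrs (insert w ?N) w = nbrs ?N w"
    by (auto simp: nbrs_def no_loop)
  moreover have "card (nbrs (insert w ?N) x) \<le> 1" if "x \<in> ?N" for x
  proof -
    have "nbrs (insert w ?N) x \<subseteq> {w}"
      using nbrs_nbrs[OF that] by (auto simp: nbrs_def)
    from card_mono[OF _ this] show ?thesis by simp
  qed
  ultimately have "sparse_set 1 G (insert w ?N)"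
    using le w assms(1) nbrs_subset[of U v] unfolding sparse_set_nbrs by auto
  moreover have "card (insert w ?N) = Suc d"
    using w assms(1,2) finite_sub[of ?N] nbrs_subset[of U v] by auto
  ultimately show False
    using assms(3) w nbrs_subset[of U v] unfolding has_sparse_def by blast
qed

lemma sum_common_nbrs:
  assumes "U \<subseteq> pverts G" "v \<in> U"
  shows "(\<Sum>w\<in>U - insert v (nbrs U v). card (nbrs (nbrs U v) w))
       = (\<Sum>x\<in>nbrs U v. card (nbrs U x) - 1)"
proof -
  let ?N = "nbrs U v" and ?W = "U - insert v (nbrs U v)"
  have fin: "finite U" using assms finite_sub by blast
  then have finN: "finite ?N" using nbrs_subset finite_subset by blast
  have "(\<Sum>w\<in>?W. card (nbrs ?N w)) = (\<Sum>x\<in>?N. card {w\<in>?W. (w, x) \<in> parcs G})"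
    unfolding nbrs_def[of ?N] using fin finN by (intro sum_multicount_gen) auto
  also have "\<dots> = (\<Sum>x\<in>?N. card (nbrs U x) - 1)"
  proof (rule sum.cong)
    fix x assume x: "x \<in> ?N"
    \<comment> \<open>Since \<open>?N\<close> is independent, every neighbour of \<open>x\<close> in
      \<open>U\<close> other than \<open>v\<close> lies in \<open>?W\<close>.\<close>
    have "{w\<in>?W. (w, x) \<in> parcs G} = nbrs U x - {v}"
      using nbrs_nbrs[OF x] by (auto simp: nbrs_def adj_commute)
    moreover have "v \<in> nbrs U x"
      using x assms(2) by (auto simp: nbrs_def adj_commute)
    ultimately show "card {w\<in>?W. (w, x) \<in> parcs G} = card (nbrs U x) - 1"
      by simp
  qed simp
  finally show ?thesis .
qed

lemma card_nonnbrs: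
  assumes "U \<subseteq> pverts G" "v \<in> U"
  shows "card (U - insert v (nbrs U v)) = card U - 1 - card (nbrs U v)"
proof -
  have "v \<notin> nbrs U v" by (simp add: nbrs_def no_loop)
  moreover have "finite (nbrs U v)"
    using finite_sub[OF assms(1)] nbrs_subset finite_subset by blast
  ultimately show ?thesis
    using assms nbrs_subset[of U v] by (subst card_Diff_subset) auto
qed

text \<open>Each of the \<open>card U - 1 - d\<close> vertices outside would need two edges into the
  neighbourhood, whose \<open>d\<close> vertices can supply only \<open>d - 1\<close> each.
  \<open>large\<close> holds for \<open>d = 2\<close> from 5 vertices on and for
  \<open>d = 3\<close> from 8 on; for \<open>d = 4\<close> and 11 vertices both sides equal
  12.\<close>

lemma degree_less:
  assumes U: "U \<subseteq> pverts G" "v \<in> U" "\<not> has_sparse (Suc d) U"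
    and large: "d * (d - 1) < 2 * (card U - 1 - d)"
  shows "card (nbrs U v) < d"
proof (rule ccontr)
  assume "\<not> card (nbrs U v) < d"
  then have d: "card (nbrs U v) = d"
    using degree_le[OF U(1,3), of v] by simp
  let ?N = "nbrs U v" and ?W = "U - insert v (nbrs U v)"
  have "2 * (card U - 1 - d) = (\<Sum>w\<in>?W. 2)"
    using card_nonnbrs[OF U(1,2)] d by simp
  also have "\<dots> \<le> (\<Sum>w\<in>?W. card (nbrs ?N w))"
    using two_common_nbrs[OF U(1) d U(3)] by (rule sum_mono)
  also have "\<dots> = (\<Sum>x\<in>?N. card (nbrs U x) - 1)"
    by (rule sum_common_nbrs[OF U(1,2)])
  also have "\<dots> \<le> (\<Sum>x\<in>?N. d - 1)"
    using degree_le[OF U(1,3)] by (intro sum_mono diff_le_mono)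
  also have "\<dots> = d * (d - 1)"
    using d by simp
  finally show False
    using large by simp
qed

text \<open>When the two bounds of the double count coincide, both estimates must be equalities term
  by term.\<close>

lemma degree_tight:
  assumes U: "U \<subseteq> pverts G" "v \<in> U" "\<not> has_sparse (Suc d) U"
    and tight: "d * (d - 1) = 2 * (card U - 1 - d)" and d: "card (nbrs U v) = d"
  shows "x \<in> nbrs U v \<Longrightarrow> card (nbrs U x) = d"
    and "w \<in> U - insert v (nbrs U v) \<Longrightarrow> card (nbrs (nbrs U v) w) = 2"
proof -
  let ?N = "nbrs U v" and ?W = "U - insert v (nbrs U v)"
  have fin: "finite ?N" "finite ?W"
    using finite_sub[OF U(1)] nbrs_subset finite_subset by blast+
  have lower: "2 \<le> card (nbrs ?N w)" if "w \<in> ?W" for w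
    using two_common_nbrs[OF U(1) d U(3) that] .
  have upper: "card (nbrs U x) - 1 \<le> d - 1" for x
    using degree_le[OF U(1,3)] by (rule diff_le_mono)
  have eq1: "(\<Sum>w\<in>?W. 2) = d * (d - 1)"
    using card_nonnbrs[OF U(1,2)] d tight by simp
  have eq2: "(\<Sum>x\<in>?N. d - 1) = d * (d - 1)"
    using d by simp
  have le1: "(\<Sum>w\<in>?W. 2) \<le> (\<Sum>w\<in>?W. card (nbrs ?N w))"
    using lower by (rule sum_mono)
  have le2: "(\<Sum>x\<in>?N. card (nbrs U x) - 1) \<le> (\<Sum>x\<in>?N. d - 1)"
    using upper by (rule sum_mono)
  note eqs = le1 le2 eq1 eq2 sum_common_nbrs[OF U(1,2)]
  have s1: "(\<Sum>w\<in>?W. 2) = (\<Sum>w\<in>?W. card (nbrs ?N w))"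
    using eqs by linarith
  have s2: "(\<Sum>x\<in>?N. card (nbrs U x) - 1) = (\<Sum>x\<in>?N. d - 1)"
    using eqs by linarith
  show "card (nbrs ?N w) = 2" if "w \<in> ?W"
    using sum_mono_inv[OF s1 lower that fin(2)] by simp
  show "card (nbrs U x) = d" if x: "x \<in> ?N"
  proof -
    have "card (nbrs U x) - 1 = d - 1"
      using sum_mono_inv[OF s2 upper x fin(1)] .
    \<comment> \<open>Subtraction truncates at 0, so both degrees must be positive before the 1 can
      be cancelled.\<close>
    moreover have "v \<in> nbrs U x"
      using x U(2) by (auto simp: nbrs_def adj_commute)
    then have "card (nbrs U x) > 0"
      using finite_sub[OF U(1)] nbrs_subset by (metis card_gt_0_iff empty_iff finite_subset)
    moreover have "d > 0"
      using d x fin(1) by (metis card_gt_0_iff empty_iff)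
    ultimately show ?thesis by linarith
  qed
qed

section \<open>Excluding degree 4 on 11 vertices\<close>

text \<open>Degree 4 makes the count tight, and tightness passes to neighbours. The contradiction is
  two neighbours of \<open>v\<close> with three common neighbours, where tightness allows exactly
  two.\<close>

lemma no_degree_4:
  assumes U: "U \<subseteq> pverts G" "v \<in> U" "\<not> has_sparse 5 U" and card_U: "card U = 11"
  shows "card (nbrs U v) \<noteq> 4"
proof
  assume deg_v: "card (nbrs U v) = 4"
  have tight: "4 * (4 - 1) = 2 * (card U - 1 - 4)" "\<not> has_sparse (Suc 4) U"
    using U card_U by simp_all
  note regular = degree_tight(1)[OF U(1) _ tight(2,1)]
   and common = degree_tight(2)[OF U(1) _ tight(2,1)]
  let ?N = "nbrs U v" and ?W = "U - insert v (nbrs U v)"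
  have fin: "finite U" "finite ?N"
    using finite_sub[OF U(1)] nbrs_subset finite_subset by blast+
  have "card ?W = 6"
    using card_nonnbrs[OF U(1,2)] card_U deg_v by simp
  then obtain w where w: "w \<in> ?W"
    by (metis card.empty ex_in_conv zero_neq_numeral)
  define A where "A = nbrs ?N w"
  have card_A: "card A = 2" and AN: "A \<subseteq> ?N"
    using common[OF U(2) deg_v w] nbrs_subset unfolding A_def by auto
  \<comment> \<open>A common neighbour \<open>a\<close> of \<open>v\<close> and \<open>w\<close>
    carries degree 4 from \<open>v\<close> to \<open>w\<close>.\<close>
  then obtain a where a: "a \<in> A"
    by (metis card.empty ex_in_conv zero_neq_numeral)
  have aU: "a \<in> U" and deg_a: "card (nbrs U a) = 4"
    using a AN nbrs_subset[of U v] regular[OF U(2) deg_v] by auto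
  have "w \<in> nbrs U a"
    using a w unfolding A_def by (auto simp: nbrs_def adj_commute)
  then have deg_w: "card (nbrs U w) = 4"
    using regular[OF aU deg_a] by simp
  define B where "B = nbrs ?W w"
  have "nbrs U w = A \<union> B"
    using w unfolding A_def B_def by (auto simp: nbrs_def adj_commute)
  moreover have "A \<inter> B = {}" "finite A" "finite B"
    unfolding A_def B_def using fin by (auto simp: nbrs_def)
  ultimately have card_B: "card B = 2"
    using deg_w card_A by (simp add: card_Un_disjoint)
  define C where "C = ?N - A"
  have card_C: "card C = 2"
    using card_A AN deg_v fin(2) unfolding C_def
    by (simp add: card_Diff_subset finite_subset)
  \<comment> \<open>As a neighbour of \<open>w\<close>, \<open>b\<close> is adjacent to nothing in
    \<open>A\<close>; its two neighbours in \<open>?N\<close> must therefore fill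
    \<open>C\<close>.\<close>
  have BC: "nbrs ?N b = C" if "b \<in> B" for b
  proof (rule card_subset_eq)
    show "finite C" using fin C_def by simp
    show "nbrs ?N b \<subseteq> C"
      using that no_triangle[of w b] unfolding B_def C_def A_def nbrs_def by blast
    show "card (nbrs ?N b) = card C"
      using common[OF U(2) deg_v] that card_C unfolding B_def by (simp add: nbrs_def)
  qed
  obtain c d where cd: "C = {c, d}" "c \<noteq> d"
    using card_C by (auto simp: card_2_iff)
  then have c: "c \<in> U" "(v, c) \<in> parcs G" and d: "d \<in> U" "(v, d) \<in> parcs G"
    unfolding C_def by (auto simp: nbrs_def)
  then have deg_c: "card (nbrs U c) = 4"
    using regular[OF U(2) deg_v] by (simp add: nbrs_def)
  \<comment> \<open>Both are neighbours of \<open>v\<close>, hence nonadjacent, so tightness at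
    \<open>c\<close> applies to \<open>d\<close>. Yet \<open>v\<close> and both elements of
    \<open>B\<close> are common neighbours.\<close>
  have "d \<in> U - insert c (nbrs U c)"
    using c d cd(2) no_triangle unfolding nbrs_def by blast
  then have "card (nbrs (nbrs U c) d) = 2"
    by (rule common[OF c(1) deg_c])
  moreover have subset: "insert v B \<subseteq> nbrs (nbrs U c) d"
  proof -
    have "(b, c) \<in> parcs G \<and> (b, d) \<in> parcs G" if "b \<in> B" for b
      using BC[OF that] cd(1) unfolding nbrs_def by blast
    moreover have "B \<subseteq> U"
      unfolding B_def nbrs_def by blast
    ultimately show ?thesis
      using c d U(2) by (auto simp: nbrs_def adj_commute)
  qed
  moreover have "card (insert v B) = 3"
  proof -
    have "v \<notin> B" "finite B"
      using fin by (auto simp: B_def nbrs_def)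
    then show ?thesis using card_B by simp
  qed
  moreover have "finite (nbrs (nbrs U c) d)"
    using fin by (simp add: nbrs_def)
  from card_mono[OF this subset] have "card (insert v B) \<le> card (nbrs (nbrs U c) d)" .
  ultimately show False
    by simp
qed

section \<open>Descent from 11 to 8 to 5 vertices\<close>

lemma has_sparse_3:
  assumes U: "U \<subseteq> pverts G" "5 \<le> card U"
  shows "has_sparse 3 U"
proof (rule ccontr)
  assume no: "\<not> has_sparse 3 U"
  then have "card (nbrs U v) < 2" if "v \<in> U" for v
    using degree_less[of U v 2] that U by simp
  then have "sparse_set 1 G U"
    using U(1) unfolding sparse_set_nbrs by force
  then show False
    using has_sparse_of_sparse_set[of U U 3] no U(2) by simp
qed

text \<open>The 8 serves twice: it is the least size at which \<open>degree_less\<close> applies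
  with \<open>d = 3\<close>, and 8 - 1 - 2 = 5 vertices suffice for
  \<open>has_sparse_3\<close>.\<close>

lemma has_sparse_4:
  assumes U: "U \<subseteq> pverts G" "8 \<le> card U"
  shows "has_sparse 4 U"
proof (rule ccontr)
  assume no: "\<not> has_sparse 4 U"
  obtain v where v: "v \<in> U"
    using U(2) by fastforce
  let ?W = "U - insert v (nbrs U v)"
  have "card (nbrs U v) < 3"
    using degree_less[of U v 3] v U no by simp
  then have "5 \<le> card ?W"
    using card_nonnbrs[OF U(1) v] U(2) by simp
  then have "has_sparse 3 ?W"
    using U(1) by (intro has_sparse_3) auto
  then show False
    using has_sparse_insert[OF U(1) v, of 3] no by simp
qed

lemma has_sparse_5:
  assumes U: "U \<subseteq> pverts G" "card U = 11"
  shows "has_sparse 5 U"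
proof (rule ccontr)
  assume no: "\<not> has_sparse 5 U"
  have le3: "card (nbrs U v) \<le> 3" if "v \<in> U" for v
    using degree_le[of U 4 v] no_degree_4[OF U(1) that no U(2)] U(1) no by simp
  have "\<exists>v\<in>U. card (nbrs U v) \<noteq> 3"
  proof (rule ccontr)
    assume "\<not> ?thesis"
    then have "(\<Sum>v\<in>U. card (nbrs U v)) = 33"
      using U(2) by simp
    then show False
      using even_sum_degree[OF finite_sub[OF U(1)]] by simp
  qed
  then obtain v where v: "v \<in> U" "card (nbrs U v) \<le> 2"
    using le3 by fastforce
  let ?W = "U - insert v (nbrs U v)"
  have "8 \<le> card ?W"
    using card_nonnbrs[OF U(1) v(1)] U(2) v(2) by simp
  then have "has_sparse 4 ?W"
    using U(1) by (intro has_sparse_4) auto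
  then show False
    using has_sparse_insert[OF U(1) v(1), of 4] no by simp
qed

end

lemma sparse_set_5_of_card_11:
  assumes "pair_graph G" "triangle_free G" "card (pverts G) = 11"
  shows "\<exists>S. sparse_set 1 G S \<and> card S = 5"
proof -
  interpret triangle_free_graph G
    using assms by (simp add: triangle_free_graph_def triangle_free_graph_axioms_def)
  show ?thesis
    using has_sparse_5[OF subset_refl assms(3)] unfolding has_sparse_def by blast
qed

section \<open>Lower bound from the doubled pentagon\<close>

text \<open>
  Residues mod 5 are the vertices of the 5-cycle. Besides \<open>n = 10\<close>, the induced subgraphs for smaller
  \<open>n\<close> are needed because \<^const>\<open>T\<close> is a least number with no monotonicity built in.
\<close>

definition doubled_pentagon :: "nat \<Rightarrow> nat pair_pre_digraph" where
  "doubled_pentagon n = \<lparr>pverts = {..<n},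
     parcs = {(x, y). x < n \<and> y < n \<and> ((x + 1) mod 5 = y mod 5 \<or> (y + 1) mod 5 = x mod 5)}\<rparr>"

lemma pair_graph_doubled_pentagon: "pair_graph (doubled_pentagon n)"
proof
  have "parcs (doubled_pentagon n) \<subseteq> {..<n} \<times> {..<n}"
    by (auto simp: doubled_pentagon_def)
  then show "finite (parcs (doubled_pentagon n))"
    by (rule finite_subset) simp
  show "fst e \<noteq> snd e" if "e \<in> parcs (doubled_pentagon n)" for e
    using that by (auto simp: doubled_pentagon_def mod_Suc split: if_splits)
qed (auto simp: doubled_pentagon_def symmetric_def sym_def)

text \<open>Three steps of +1 or -1 have an odd sum of absolute value at most 3, which is never 0
  mod 5.\<close>

lemma triangle_free_doubled_pentagon: "triangle_free (doubled_pentagon n)"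
  unfolding triangle_free_def doubled_pentagon_def by (auto simp: mod_Suc split: if_splits)

lemma no_sparse_doubled_pentagon:
  assumes "n \<le> 10" "sparse_set 1 (doubled_pentagon n) S"
  shows "card S \<noteq> 5"
proof -
  define A where "A r = {x\<in>S. x mod 5 = r}" for r
  have S10: "S \<subseteq> {..<n}"
    using assms(2) by (auto simp: sparse_set_altdef doubled_pentagon_def)
  then have finA: "finite (A r)" for r
    unfolding A_def by (auto intro: finite_subset)
  have A_le: "card (A r) \<le> 2" for r
  proof -
    have "A r \<subseteq> {r, r + 5}"
    proof
      fix x assume "x \<in> A r"
      then have "x < 10" "x mod 5 = r"
        using S10 assms(1) by (auto simp: A_def)
      then show "x \<in> {r, r + 5}" by simp presburger
    qed
    from card_mono[OF _ this] show ?thesis by simp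
  qed
  \<comment> \<open>A vertex of \<open>S\<close> in class \<open>r\<close> is adjacent to everything
    in the two neighbouring classes \<open>p\<close> and \<open>q\<close>.\<close>
  have nonadj: "card (A p) + card (A q) \<le> 1"
    if r: "card (A r) > 0" and pq: "p = (r + 1) mod 5" "r = (q + 1) mod 5" "p \<noteq> q" for p q r
  proof -
    obtain v where v: "v \<in> S" "v mod 5 = r"
      using r unfolding A_def card_gt_0_iff by blast
    have "(v + 1) mod 5 = p"
      using pq(1) v(2) by (metis mod_add_left_eq)
    moreover have "(x + 1) mod 5 = v mod 5" if "x \<in> A q" for x
      using that pq(2) v(2) unfolding A_def by (metis (mono_tags) mem_Collect_eq mod_add_left_eq)
    ultimately have "A p \<union> A q \<subseteq> {w \<in> S. (v, w) \<in> parcs (doubled_pentagon n)}"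
      using S10 v(1) unfolding A_def doubled_pentagon_def by auto
    moreover have "finite {w \<in> S. (v, w) \<in> parcs (doubled_pentagon n)}"
      using finite_subset[OF S10] by simp
    ultimately have "card (A p \<union> A q) \<le> card {w \<in> S. (v, w) \<in> parcs (doubled_pentagon n)}"
      by (intro card_mono)
    also have "\<dots> \<le> 1"
      using assms(2) v(1) unfolding sparse_set_altdef by blast
    finally have "card (A p \<union> A q) \<le> 1" .
    moreover have "A p \<inter> A q = {}"
      using pq(3) by (auto simp: A_def)
    ultimately show ?thesis
      using finA by (simp add: card_Un_disjoint)
  qed
  have "S = (\<Union>r<5. A r)"
    by (auto simp: A_def)
  then have "card S = (\<Sum>r<5. card (A r))"
    using finA by (subst card_UN_disjoint[symmetric]) (auto simp: A_def)
  then have "card S = card (A 0) + card (A 1) + card (A 2) + card (A 3) + card (A 4)"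
    by (simp add: eval_nat_numeral)
  \<comment> \<open>No three consecutive classes are occupied, and two consecutive occupied ones
    have size 1 each. So at most three classes are occupied, and the sum is at most 4 in every
    case.\<close>
  moreover have arith: "a + b + c + d + e \<noteq> 5"
    if "0 < a \<Longrightarrow> b + e \<le> 1" "0 < b \<Longrightarrow> c + a \<le> 1" "0 < c \<Longrightarrow> d + b \<le> 1"
      "0 < d \<Longrightarrow> e + c \<le> 1" "0 < e \<Longrightarrow> a + d \<le> 1"
      "a \<le> 2" "b \<le> 2" "c \<le> 2" "d \<le> 2" "e \<le> 2" for a b c d e :: nat
    using that by (cases "a = 0"; cases "b = 0"; cases "c = 0"; cases "d = 0"; cases "e = 0"; simp)
  have "card (A 0) + card (A 1) + card (A 2) + card (A 3) + card (A 4) \<noteq> 5"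
  proof (rule arith)
    show "card (A 1) + card (A 4) \<le> 1" if "0 < card (A 0)"
      using that by (rule nonadj) simp_all
    show "card (A 2) + card (A 0) \<le> 1" if "0 < card (A 1)"
      using that by (rule nonadj) simp_all
    show "card (A 3) + card (A 1) \<le> 1" if "0 < card (A 2)"
      using that by (rule nonadj) simp_all
    show "card (A 4) + card (A 2) \<le> 1" if "0 < card (A 3)"
      using that by (rule nonadj) simp_all
    show "card (A 0) + card (A 3) \<le> 1" if "0 < card (A 4)"
      using that by (rule nonadj) simp_all
  qed (rule A_le)+
  ultimately show ?thesis by simp
qed

theorem theorem3p2:
  "T 1 5 = 11 \<and>
   (\<forall>G :: 'a pair_pre_digraph.
      pair_graph G \<and> triangle_free G \<and> card (pverts G) = 11 \<longrightarrow>
        (\<exists>S. sparse_set 1 G S \<and> card S = 5)) \<and>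
   (\<exists>G :: nat pair_pre_digraph.
      pair_graph G \<and> triangle_free G \<and> card (pverts G) = 10 \<and>
        \<not> (\<exists>S. sparse_set 1 G S \<and> card S = 5))"
proof (intro conjI)
  have witness: "pair_graph (doubled_pentagon n) \<and> triangle_free (doubled_pentagon n) \<and>
      card (pverts (doubled_pentagon n)) = n \<and>
      \<not> (\<exists>S. sparse_set 1 (doubled_pentagon n) S \<and> card S = 5)" if "n \<le> 10" for n
    using pair_graph_doubled_pentagon triangle_free_doubled_pentagon
      no_sparse_doubled_pentagon[OF that]
    by (auto simp: doubled_pentagon_def)
  show "\<exists>G :: nat pair_pre_digraph.
      pair_graph G \<and> triangle_free G \<and> card (pverts G) = 10 \<and>
        \<not> (\<exists>S. sparse_set 1 G S \<and> card S = 5)"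
    using witness[of 10] by blast
  show "T 1 5 = 11"
    unfolding T_def
  proof (rule Least_equality)
    fix n
    assume "\<forall>G :: nat pair_pre_digraph.
      pair_graph G \<and> triangle_free G \<and> card (pverts G) = n \<longrightarrow>
        (\<exists>S. sparse_set 1 G S \<and> card S = 5)"
    then have "\<not> n \<le> 10"
      using witness by blast
    then show "11 \<le> n" by simp
  qed (use sparse_set_5_of_card_11 in blast)
qed (use sparse_set_5_of_card_11 in blast)

end
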